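(* Let $q$ be a prime power and let $n,k,\ell$ be three positive integers such that $\ell\leq k\leq n-\ell$. Let $k_0=k-\ell$. Then $$|{\rm HHull}[n,k]^\ell_{q^2}|=\begin{cases} \left(\prod_{i=1}^\ell A_{n,k_0,i}\right) q^{k_0(n-k_0)}\prod_{i=1}^{k_0}\frac{q^{n-k_0+i}-(-1)^{n-k_0+i}} {q^i-(-1)^i}, & \text{if } n-k_0 \text{ is odd}, \\ \left(\prod_{i=1}^\ell B_{n,k_0,i}\right) q^{k_0(n-k_0)}\prod_{i=1}^{k_0}\frac{q^{n-k_0+i}-(-1)^{n-k_0+i}} {q^i-(-1)^i}, & \text{if } n-k_0 \text{ is even}, \end{cases}$$ where $$A_{n,k_0,i}=\frac{(q^{n-k_0-2i+2}+1)(q^{n-k_0-2i+1}-1)}{q^{2k_0}(q^{2i}-1)}\quad\text{and}\quad B_{n,k_0,i}=\frac{(q^{n-k_0-2i+2}-1)(q^{n-k_0-2i+1}+1)}{q^{2k_0}(q^{2i}-1)}.$$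
   Context: $\mathbb{F}_{q^2}$ is the field with $q^2$ elements. A linear $[n,k]_{q^2}$ code is a $k$-dimensional subspace $C$ of $\mathbb{F}_{q^2}^n$. The Hermitian inner product is $\langle \mathbf{x},\mathbf{y}\rangle_{\rm H}=\sum_{i=1}^n x_iy_i^q$, and $C^{\perp_{\rm H}}=\{\mathbf{y}\in\mathbb{F}_{q^2}^n : \langle \mathbf{x},\mathbf{y}\rangle_{\rm H}=0 \text{ for all } \mathbf{x}\in C\}$. The Hermitian hull of $C$ is ${\rm Hull_H}(C)=C\cap C^{\perp_{\rm H}}$. ${\rm HHull}[n,k]^{\ell}_{q^2}$ denotes the set of all linear $[n,k]_{q^2}$ codes whose Hermitian hull has dimension $\ell$ (distinct subspaces are counted as distinct codes). Empty products equal $1$. *)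

theory Defs
  imports "HOL-Analysis.Analysis" "HOL-Number_Theory.Prime_Powers"
begin

text \<open>
  The field with \<open>q\<^sup>2\<close> elements is a finite field type \<open>'a\<close> with \<open>CARD('a) = q\<^sup>2\<close>, and its
  \<open>n\<close>-th power is \<open>'a ^ 'n\<close> with \<open>CARD('n) = n\<close>. Since \<open>q\<close> is not a function of the type
  that Isabelle can infer, it is an explicit argument below. Subspaces and dimensions are those
  of the vector space \<open>'a ^ 'n\<close> over \<open>'a\<close>, with scalar multiplication \<open>(*s)\<close>.
\<close>

definition herm_inner :: "nat \<Rightarrow> 'a::field ^ 'n \<Rightarrow> 'a ^ 'n \<Rightarrow> 'a" where
  "herm_inner q x y = (\<Sum>i\<in>UNIV. x $ i * (y $ i) ^ q)"

definition herm_dual :: "nat \<Rightarrow> ('a::field ^ 'n) set \<Rightarrow> ('a ^ 'n) set" where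
  "herm_dual q C = {y. \<forall>x\<in>C. herm_inner q x y = 0}"

definition herm_hull :: "nat \<Rightarrow> ('a::field ^ 'n) set \<Rightarrow> ('a ^ 'n) set" where
  "herm_hull q C = C \<inter> herm_dual q C"

definition linear_code :: "nat \<Rightarrow> ('a::field ^ 'n) set \<Rightarrow> bool" where
  "linear_code k C \<longleftrightarrow> vec.subspace C \<and> vec.dim C = k"

definition HHull :: "nat \<Rightarrow> nat \<Rightarrow> nat \<Rightarrow> ('a::field ^ 'n) set set" where
  "HHull q k l = {C. linear_code k C \<and> vec.dim (herm_hull q C) = l}"

text \<open>
  The exponents below are natural numbers; they are only used for \<open>1 \<le> i\<close> and
  \<open>2 * i \<le> n - k0\<close>, where the subtractions do not truncate.
\<close>

definition hull_A :: "nat \<Rightarrow> nat \<Rightarrow> nat \<Rightarrow> nat \<Rightarrow> real" where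
  "hull_A q n k0 i =
     ((real q ^ (n - k0 - 2 * i + 2) + 1) * (real q ^ (n - k0 - 2 * i + 1) - 1)) /
     (real q ^ (2 * k0) * (real q ^ (2 * i) - 1))"

definition hull_B :: "nat \<Rightarrow> nat \<Rightarrow> nat \<Rightarrow> nat \<Rightarrow> real" where
  "hull_B q n k0 i =
     ((real q ^ (n - k0 - 2 * i + 2) - 1) * (real q ^ (n - k0 - 2 * i + 1) + 1)) /
     (real q ^ (2 * k0) * (real q ^ (2 * i) - 1))"

end

theory Submission
  imports Defs "HOL-Number_Theory.Residues"
begin

text \<open>
  Let \<open>W\<close> be a nondegenerate Hermitian space; the count of its subspaces with given dimension and
  hull dimension is by induction on the dimension of \<open>W\<close>. If \<open>e \<in> W\<close> is anisotropic, then
  \<open>C \<mapsto> C \<inter> e\<^sup>\<bottom>\<close> is a bijection from the subspaces of \<open>W\<close> that contain \<open>e\<close> onto the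
  subspaces of the nondegenerate space \<open>W \<inter> e\<^sup>\<bottom>\<close>; it lowers the dimension by one and preserves the
  hull. Double counting the pairs \<open>(e, C)\<close> with \<open>e \<in> C\<close> anisotropic reduces the count to the case
  \<open>k = l\<close> of totally isotropic subspaces. For those, one double counts the pairs \<open>(v, C)\<close> with
  \<open>0 \<noteq> v \<in> C\<close>: when \<open>v, w\<close> are in \<open>W\<close> with \<open>v\<close> isotropic and \<open>h v w \<noteq> 0\<close>, the map
  \<open>C \<mapsto> C \<inter> w\<^sup>\<bottom>\<close> is a bijection onto the totally isotropic subspaces of \<open>W \<inter> v\<^sup>\<bottom> \<inter> w\<^sup>\<bottom>\<close>.
  The number of isotropic vectors of a space depends only on its dimension and that of its
  radical, again by splitting off an anisotropic vector, since the norm \<open>a \<mapsto> a ^ (q + 1)\<close> takes each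
  nonzero value of the subfield with \<open>q\<close> elements exactly \<open>q + 1\<close> times.
\<close>

subsection \<open>Finite fields and their vector spaces\<close>

lemma card_span_independent:
  fixes B :: "('a::{field,finite} ^ 'n::finite) set"
  assumes "vec.independent B"
  shows "card (vec.span B) = CARD('a) ^ card B"
proof -
  have "finite B" by simp
  then show ?thesis using assms
  proof (induction B rule: finite_induct)
    case empty
    then show ?case by simp
  next
    case (insert b B)
    have b: "b \<notin> vec.span B" and B: "vec.independent B"
      using insert.prems insert.hyps by (simp_all add: vec.independent_insert)
    have inj: "inj_on (\<lambda>(a, w). a *s b + w) (UNIV \<times> vec.span B)"
    proof (rule inj_onI, clarify)
      fix a a' w w'
      assume w: "w \<in> vec.span B" "w' \<in> vec.span B" and eq: "a *s b + w = a' *s b + w'"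
      have "(a - a') *s b = w' - w"
        using eq by (simp add: vec.scale_left_diff_distrib algebra_simps)
      then have "(a - a') *s b \<in> vec.span B"
        using w by (simp add: vec.span_diff)
      then have "(inverse (a - a') * (a - a')) *s b \<in> vec.span B"
        unfolding vec.scale_scale[symmetric] by (rule vec.span_scale)
      then have "a = a'"
        using b by (cases "a = a'") (simp_all del: left_diff_distrib right_diff_distrib)
      then show "a = a' \<and> w = w'" using eq by simp
    qed
    have "vec.span (insert b B) = (\<lambda>(a, w). a *s b + w) ` (UNIV \<times> vec.span B)"
    proof (intro subset_antisym subsetI)
      fix x assume "x \<in> vec.span (insert b B)"
      then obtain a where "x - a *s b \<in> vec.span B"
        by (auto simp: vec.span_insert)
      then show "x \<in> (\<lambda>(a, w). a *s b + w) ` (UNIV \<times> vec.span B)"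
        by (intro image_eqI[of _ _ "(a, x - a *s b)"]) auto
    next
      fix x assume "x \<in> (\<lambda>(a, w). a *s b + w) ` (UNIV \<times> vec.span B)"
      then obtain a w where "x = a *s b + w" "w \<in> vec.span B" by auto
      then show "x \<in> vec.span (insert b B)"
        by (auto simp: vec.span_insert intro!: exI[of _ a])
    qed
    then have "card (vec.span (insert b B)) = CARD('a) * card (vec.span B)"
      using inj by (simp add: card_image card_cartesian_product)
    then show ?case using insert.IH[OF B] insert.hyps by simp
  qed
qed

lemma card_subspace:
  fixes C :: "('a::{field,finite} ^ 'n::finite) set"
  assumes "vec.subspace C"
  shows "card C = CARD('a) ^ vec.dim C"
proof -
  obtain B where B: "B \<subseteq> C" "vec.independent B" "C \<subseteq> vec.span B" "card B = vec.dim C"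
    using vec.basis_exists[of C] by blast
  moreover have "vec.span B = C"
    using B assms by (metis vec.span_subspace)
  ultimately show ?thesis using card_span_independent[of B] by simp
qed

lemma card_power_eq_le:
  fixes c :: "'a::{field,finite}"
  assumes "m > 0"
  shows "card {x. x ^ m = c} \<le> m"
proof -
  let ?p = "Polynomial.monom 1 m - [:c:]"
  have deg: "degree ?p = m"
    using assms by (subst diff_conv_add_uminus, subst degree_add_eq_left) (auto simp: degree_monom_eq)
  then have "?p \<noteq> 0" using assms by auto
  then have "card {x. poly ?p x = 0} \<le> degree ?p"
    by (rule card_poly_roots_bound)
  then show ?thesis by (simp add: deg poly_monom)
qed

text \<open>Multiplication by \<open>x\<close> permutes the nonzero elements, so their product is
  unchanged by the factor \<open>x ^ (CARD('a) - 1)\<close>.\<close>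

lemma nonzero_power_card_pred:
  fixes x :: "'a::{field,finite}"
  assumes "x \<noteq> 0"
  shows "x ^ (CARD('a) - 1) = 1"
proof -
  have "(\<Prod>y\<in>-{0}. x * y) = (\<Prod>y\<in>-{0}. y)"
    by (rule prod.reindex_bij_witness[of _ "\<lambda>y. y / x" "\<lambda>y. x * y"]) (use assms in auto)
  moreover have "(\<Prod>y\<in>-{0}. x * y) = x ^ (CARD('a) - 1) * (\<Prod>y\<in>-{0}. y)"
    by (simp add: prod.distrib Compl_eq_Diff_UNIV card_Diff_singleton)
  moreover have "(\<Prod>y\<in>-{0::'a}. y) \<noteq> 0"
    by simp
  ultimately show ?thesis by simp
qed

text \<open>The prime \<open>CHAR('a)\<close> divides a power of the prime below \<open>q\<close>,
  so the two agree. This form of \<open>q\<close> makes \<open>x ^ q\<close> additive in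
  \<open>x\<close>.\<close>

lemma primepow_eq_CHAR_power:
  assumes "primepow q" "CARD('a::{field,finite}) = q ^ m"
  obtains e where "prime CHAR('a)" "q = CHAR('a) ^ e"
proof -
  obtain p e where p: "prime p" "q = p ^ e"
    using assms(1) by (auto simp: primepow_def)
  have "CHAR('a) dvd p ^ (e * m)"
    using CHAR_dvd_CARD[where 'a = 'a] assms(2) p by (simp add: power_mult)
  moreover have pr: "prime CHAR('a)"
    by (rule prime_CHAR_semidom) (simp add: finite_imp_CHAR_pos)
  ultimately have "CHAR('a) = p"
    using p(1) by (meson prime_dvd_power primes_dvd_imp_eq)
  then show ?thesis using that pr p by simp
qed

subsection \<open>Hermitian forms\<close>

text \<open>Nondegeneracy is imposed on single subspaces, as \<open>radical W = {0}\<close>, because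
  the inductions pass to smaller subspaces.\<close>

locale hermitian_form =
  fixes q :: nat
    and h :: "'a::{field,finite} ^ 'n::finite \<Rightarrow> 'a ^ 'n \<Rightarrow> 'a"
  assumes primepow_q: "primepow q"
    and card_field: "CARD('a) = q\<^sup>2"
    and add_left: "h (x + y) z = h x z + h y z"
    and scale_left: "h (c *s x) z = c * h x z"
    and conj_sym: "h x y = h y x ^ q"
begin

section \<open>Frobenius, norm and trace on the field\<close>

lemma q_gt_1: "q > 1"
  using primepow_q by (rule primepow_gt_Suc_0[unfolded One_nat_def[symmetric]])

lemma frobenius_add: "((x::'a) + y) ^ q = x ^ q + y ^ q"
  using primepow_eq_CHAR_power[OF primepow_q card_field] freshmans_dream' by metis

lemma frobenius_zero [simp]: "(0::'a) ^ q = 0"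
  using q_gt_1 by simp

lemma frobenius_minus: "(- x::'a) ^ q = - (x ^ q)"
  using frobenius_add[of x "-x"] by (simp add: eq_neg_iff_add_eq_0 add.commute)

text \<open>
  The norm maps the \<open>(q - 1) (q + 1)\<close> units into the at most \<open>q - 1\<close> roots of \<open>c ^ (q - 1) = 1\<close>,
  with at most \<open>q + 1\<close> units over each root, so both bounds are attained.
\<close>
lemma card_norm_fibre:
  fixes c :: 'a
  assumes "c \<noteq> 0" "c ^ q = c"
  shows "card {a. a * a ^ q = c} = q + 1"
proof -
  let ?K = "{c::'a. c ^ (q - 1) = 1}"
  let ?N = "\<lambda>c::'a. {a. a ^ (q + 1) = c}"
  have le: "card (?N d) \<le> q + 1" for d
    by (rule card_power_eq_le) simp
  have K: "card ?K \<le> q - 1"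
    using q_gt_1 by (intro card_power_eq_le) simp
  have q2: "q\<^sup>2 - 1 = (q + 1) * (q - 1)"
    using q_gt_1 by (simp add: power2_eq_square algebra_simps)
  have units: "- {0} = (\<Union>d\<in>?K. ?N d)"
  proof (intro subset_antisym subsetI)
    fix x :: 'a assume "x \<in> - {0}"
    then have "(x ^ (q + 1)) ^ (q - 1) = 1"
      using nonzero_power_card_pred[of x] q2 by (metis power_mult ComplD insertCI card_field)
    then show "x \<in> (\<Union>d\<in>?K. ?N d)" by auto
  next
    fix x :: 'a assume "x \<in> (\<Union>d\<in>?K. ?N d)"
    then show "x \<in> - {0}" using q_gt_1 by (auto simp: power_0_left)
  qed
  have cK: "c \<in> ?K"
  proof -
    have "c * c ^ (q - 1) = c ^ q"
      using q_gt_1 by (metis power_eq_if not_less_zero)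
    then show ?thesis using assms by simp
  qed
  have "q\<^sup>2 - 1 = card (- {0::'a})"
    by (simp add: Compl_eq_Diff_UNIV card_Diff_singleton card_field)
  also have "\<dots> = (\<Sum>d\<in>?K. card (?N d))"
    unfolding units by (rule card_UN_disjoint) auto
  also have "\<dots> = card (?N c) + (\<Sum>d\<in>?K - {c}. card (?N d))"
    by (rule sum.remove) (use cK in auto)
  also have "(\<Sum>d\<in>?K - {c}. card (?N d)) \<le> card (?K - {c}) * (q + 1)"
    using sum_bounded_above[of "?K - {c}" "\<lambda>d. card (?N d)" "q + 1"] le by simp
  also have "\<dots> \<le> (q - 2) * (q + 1)"
    using K cK by (intro mult_right_mono) (auto simp: card_Diff_singleton)
  finally have "q\<^sup>2 - 1 \<le> card (?N c) + (q - 2) * (q + 1)" by simp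
  moreover have "q\<^sup>2 - 1 = (q + 1) + (q - 2) * (q + 1)"
    using q_gt_1 unfolding q2 by (cases q; cases "q - 1") (auto simp: algebra_simps)
  ultimately have "card (?N c) = q + 1"
    using le[of c] by linarith
  then show ?thesis by simp
qed

text \<open>Otherwise every nonzero \<open>b\<close> would satisfy \<open>b ^ (q - 1) = -1\<close>,
  which has at most \<open>q - 1\<close> solutions.\<close>

lemma exists_trace_nonzero: "\<exists>b::'a. b + b ^ q \<noteq> 0"
proof (rule ccontr)
  assume "\<not> ?thesis"
  then have *: "b ^ q = - b" for b :: 'a
    by (metis add.commute eq_neg_iff_add_eq_0)
  then have "b ^ (q - 1) = -1" if "b \<noteq> 0" for b :: 'a
  proof -
    have "b * b ^ (q - 1) = b ^ q"
      using q_gt_1 by (metis power_eq_if not_less_zero)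
    also have "\<dots> = b * (-1)" using * by simp
    finally show ?thesis using that by (metis mult_left_cancel)
  qed
  then have "card (- {0::'a}) \<le> card {b::'a. b ^ (q - 1) = -1}"
    by (intro card_mono) auto
  also have "\<dots> \<le> q - 1"
    using q_gt_1 by (intro card_power_eq_le) simp
  finally have "q\<^sup>2 \<le> q" using q_gt_1
    by (simp add: Compl_eq_Diff_UNIV card_Diff_singleton card_field)
  then show False using q_gt_1 by (simp add: power2_eq_square)
qed

section \<open>Sesquilinearity, orthogonality and radicals\<close>

lemma add_right: "h z (x + y) = h z x + h z y"
  using conj_sym[of z] conj_sym[of _ z]
  by (metis add_left frobenius_add)

lemma scale_right: "h z (c *s x) = c ^ q * h z x"
  by (metis conj_sym scale_left power_mult_distrib)

lemma zero_left [simp]: "h 0 z = 0"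
  using scale_left[of 0 0 z] by simp

lemma zero_right [simp]: "h z 0 = 0"
  using conj_sym[of z 0] by simp

lemma minus_left: "h (- x) z = - h x z"
  using scale_left[of "-1" x z] by simp

lemma diff_left: "h (x - y) z = h x z - h y z"
  using add_left[of x "- y" z] by (simp add: minus_left)

lemma orth_sym: "h x y = 0 \<longleftrightarrow> h y x = 0"
  by (metis conj_sym frobenius_zero)

text \<open>\<open>f\<close> need not lie in \<open>U\<close>: splitting off a hyperbolic pair uses
  \<open>perp (perp W v) w\<close> with \<open>w\<close> outside \<open>perp W v\<close>.\<close>

definition perp :: "('a ^ 'n) set \<Rightarrow> 'a ^ 'n \<Rightarrow> ('a ^ 'n) set" where
  "perp U f = {x \<in> U. h x f = 0}"

text \<open>This is \<open>herm_hull q C\<close> when \<open>h\<close> is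
  \<open>herm_inner q\<close>.\<close>

definition radical :: "('a ^ 'n) set \<Rightarrow> ('a ^ 'n) set" where
  "radical C = {y \<in> C. \<forall>x\<in>C. h x y = 0}"

definition isotropic :: "('a ^ 'n) set \<Rightarrow> ('a ^ 'n) set" where
  "isotropic C = {x \<in> C. h x x = 0}"

definition codes :: "('a ^ 'n) set \<Rightarrow> nat \<Rightarrow> nat \<Rightarrow> ('a ^ 'n) set set" where
  "codes W k l = {C. vec.subspace C \<and> C \<subseteq> W \<and> vec.dim C = k \<and> vec.dim (radical C) = l}"

lemma subspace_perp: "vec.subspace U \<Longrightarrow> vec.subspace (perp U f)"
  by (auto simp: perp_def vec.subspace_def add_left scale_left)

lemma subspace_radical: "vec.subspace U \<Longrightarrow> vec.subspace (radical U)"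
  by (auto simp: radical_def vec.subspace_def add_right scale_right)

lemma radical_subset: "radical U \<subseteq> U"
  by (auto simp: radical_def)

lemma perp_subset: "perp U f \<subseteq> U"
  by (auto simp: perp_def)

lemma perp_mono: "C \<subseteq> U \<Longrightarrow> perp C f \<subseteq> perp U f"
  by (auto simp: perp_def)

section \<open>Splitting off a vector\<close>

lemma perp_decompose:
  assumes "vec.subspace U" "e \<in> U" "h e f \<noteq> 0" "x \<in> U"
  obtains a w where "w \<in> perp U f" "x = a *s e + w"
proof
  \<comment> \<open>The coefficient solves \<open>h (x - a *s e) f = 0\<close> for
    \<open>a\<close>.\<close>
  let ?a = "h x f / h e f"
  show "x - ?a *s e \<in> perp U f"
    using assms by (simp add: perp_def vec.subspace_diff vec.subspace_scale diff_left scale_left)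
  show "x = ?a *s e + (x - ?a *s e)" by simp
qed

lemma bij_betw_perp:
  assumes "vec.subspace U" "e \<in> U" "h e f \<noteq> 0"
  shows "bij_betw (\<lambda>(a, w). a *s e + w) (UNIV \<times> perp U f) U"
  unfolding bij_betw_def
proof
  show "inj_on (\<lambda>(a, w). a *s e + w) (UNIV \<times> perp U f)"
  proof (rule inj_onI, clarify)
    fix a a' w w'
    assume w: "w \<in> perp U f" "w' \<in> perp U f" and eq: "a *s e + w = a' *s e + w'"
    have "h (a *s e + w) f = h (a' *s e + w') f" using eq by simp
    then have "a = a'" using w assms(3) by (simp add: add_left scale_left perp_def)
    then show "a = a' \<and> w = w'" using eq by simp
  qed
  show "(\<lambda>(a, w). a *s e + w) ` (UNIV \<times> perp U f) = U"
  proof (intro subset_antisym subsetI)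
    fix x assume "x \<in> (\<lambda>(a, w). a *s e + w) ` (UNIV \<times> perp U f)"
    then show "x \<in> U" using assms(1,2) by (auto simp: perp_def vec.subspace_add vec.subspace_scale)
  next
    fix x assume "x \<in> U"
    then show "x \<in> (\<lambda>(a, w). a *s e + w) ` (UNIV \<times> perp U f)"
      using perp_decompose[OF assms] by (smt (verit) SigmaI UNIV_I case_prod_conv image_eqI)
  qed
qed

text \<open>By \<open>bij_betw_perp\<close> the cardinalities differ by the factor
  \<open>q ^ 2\<close>, and cardinality determines dimension.\<close>

lemma dim_perp:
  assumes "vec.subspace U" "e \<in> U" "h e f \<noteq> 0"
  shows "vec.dim U = vec.dim (perp U f) + 1"
proof -
  have "q\<^sup>2 ^ vec.dim U = card U"
    using card_subspace[OF assms(1)] card_field by simp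
  also have "\<dots> = card (UNIV \<times> perp U f :: ('a \<times> _) set)"
    using bij_betw_same_card[OF bij_betw_perp[OF assms]] by simp
  also have "\<dots> = q\<^sup>2 ^ (vec.dim (perp U f) + 1)"
    using card_subspace[OF subspace_perp[OF assms(1)]] card_field
    by (simp add: card_cartesian_product)
  finally show ?thesis
    using power_inject_exp[of "q\<^sup>2"] q_gt_1 by (metis one_less_power zero_less_numeral)
qed

text \<open>\<open>C\<close> is the orthogonal sum of \<open>perp C e\<close> and the line of
  \<open>e\<close>, and that line has zero radical.\<close>

lemma radical_perp:
  assumes "vec.subspace C" "e \<in> C" "h e e \<noteq> 0"
  shows "radical (perp C e) = radical C"
proof (intro subset_antisym subsetI)
  fix y assume y: "y \<in> radical (perp C e)"
  have "h x y = 0" if x: "x \<in> C" for x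
  proof -
    obtain a w where "w \<in> perp C e" "x = a *s e + w"
      using perp_decompose[OF assms x] .
    then show ?thesis
      using y orth_sym by (auto simp: radical_def perp_def add_left scale_left)
  qed
  then show "y \<in> radical C" using y by (auto simp: radical_def perp_def)
next
  fix y assume "y \<in> radical C"
  then show "y \<in> radical (perp C e)"
    using assms(2) orth_sym by (auto simp: radical_def perp_def)
qed

text \<open>Two splittings write each vector of \<open>W\<close> as a combination of
  \<open>v\<close>, \<open>w\<close> and a vector of the double \<open>perp\<close>. A radical
  vector of the latter is orthogonal to all three, hence lies in \<open>radical W\<close>.\<close>

lemma radical_perp_hyperbolic:
  assumes W: "vec.subspace W" and v: "v \<in> W" "h v v = 0" and w: "w \<in> W" "h v w \<noteq> 0"
    and nondeg: "radical W = {0}"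
  shows "radical (perp (perp W v) w) = {0}"
proof -
  have wv: "h w v \<noteq> 0" using w orth_sym by blast
  have vW: "v \<in> perp W v" using v by (simp add: perp_def)
  have "y = 0" if y: "y \<in> radical (perp (perp W v) w)" for y
  proof -
    have "h x y = 0" if x: "x \<in> W" for x
    proof -
      obtain a u where u: "u \<in> perp W v" "x = a *s w + u"
        using perp_decompose[OF W w(1) wv x] .
      obtain b t where "t \<in> perp (perp W v) w" "u = b *s v + t"
        using perp_decompose[OF subspace_perp[OF W] vW w(2) u(1)] .
      then show ?thesis
        using u(2) y orth_sym by (auto simp: radical_def perp_def add_left scale_left)
    qed
    then have "y \<in> radical W" using y by (auto simp: radical_def perp_def)
    then show ?thesis using nondeg by simp
  qed
  moreover have "0 \<in> radical (perp (perp W v) w)"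
    using W by (simp add: vec.subspace_0 subspace_perp subspace_radical)
  ultimately show ?thesis by blast
qed

text \<open>Polarization: for isotropic \<open>x\<close> and \<open>y\<close>, the form takes on
  \<open>a *s x + y\<close> the trace of \<open>a * h x y\<close> as its value.\<close>

lemma radical_eq_self:
  assumes "\<And>x. x \<in> C \<Longrightarrow> h x x = 0" and "vec.subspace C"
  shows "radical C = C"
proof -
  have "h x y = 0" if x: "x \<in> C" and y: "y \<in> C" for x y
  proof (rule ccontr)
    assume nz: "h x y \<noteq> 0"
    obtain b :: 'a where b: "b + b ^ q \<noteq> 0" using exists_trace_nonzero by blast
    \<comment> \<open>Chosen so that \<open>?a * h x y = b\<close>, whose trace is nonzero.\<close>
    let ?a = "b / h x y"
    have "?a *s x + y \<in> C" using assms(2) x y by (simp add: vec.subspace_add vec.subspace_scale)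
    then have "h (?a *s x + y) (?a *s x + y) = 0" by (rule assms(1))
    moreover have "h (?a *s x + y) (?a *s x + y) = ?a * h x y + (?a * h x y) ^ q"
      using assms(1)[OF x] assms(1)[OF y] conj_sym[of y x] unfolding power_mult_distrib
      by (simp add: add_left add_right scale_left scale_right)
    ultimately show False using b nz by simp
  qed
  then show ?thesis by (auto simp: radical_def)
qed

lemma exists_anisotropic:
  assumes "vec.subspace C" "vec.dim (radical C) < vec.dim C"
  obtains e where "e \<in> C" "h e e \<noteq> 0"
  using radical_eq_self[OF _ assms(1)] assms(2) by (metis less_irrefl)

subsection \<open>Counting isotropic vectors\<close>

text \<open>The vector \<open>a *s e + w\<close> is isotropic iff the norm of \<open>a\<close> is
  \<open>- h w w / h e e\<close>: one solution \<open>a\<close> if \<open>w\<close> is isotropic,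
  \<open>q + 1\<close> otherwise.\<close>

lemma card_isotropic_step:
  assumes "vec.subspace C" "e \<in> C" "h e e \<noteq> 0"
  shows "card (isotropic C) + q * card (isotropic (perp C e)) = (q + 1) * card (perp C e)"
proof -
  let ?D = "perp C e"
  let ?I = "isotropic ?D"
  let ?f = "\<lambda>(a, w). a *s e + w"
  let ?S = "SIGMA w:?D. {a. a * a ^ q * h e e + h w w = 0}"
  have norm: "h (a *s e + w) (a *s e + w) = a * a ^ q * h e e + h w w" if "w \<in> ?D" for a w
    using that orth_sym by (auto simp: perp_def add_left add_right scale_left scale_right)
  have bij: "bij_betw ?f (UNIV \<times> ?D) C" by (rule bij_betw_perp[OF assms])
  have "bij_betw (\<lambda>(w, a). a *s e + w) ?S (isotropic C)"
  proof -
    have "bij_betw prod.swap ?S {(a, w). w \<in> ?D \<and> h (a *s e + w) (a *s e + w) = 0}"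
      by (rule bij_betwI[where g = prod.swap]) (auto simp: norm)
    moreover have "bij_betw ?f {(a, w). w \<in> ?D \<and> h (a *s e + w) (a *s e + w) = 0} (isotropic C)"
      unfolding bij_betw_def
    proof
      show "inj_on ?f {(a, w). w \<in> ?D \<and> h (a *s e + w) (a *s e + w) = 0}"
        using bij_betw_imp_inj_on[OF bij] by (rule inj_on_subset) auto
      show "?f ` {(a, w). w \<in> ?D \<and> h (a *s e + w) (a *s e + w) = 0} = isotropic C"
        using bij_betw_imp_surj_on[OF bij] unfolding isotropic_def by force
    qed
    ultimately have "bij_betw (?f \<circ> prod.swap) ?S (isotropic C)" by (rule bij_betw_trans)
    then show ?thesis by (simp add: comp_def case_prod_unfold)
  qed
  then have "card (isotropic C) = card ?S" by (rule bij_betw_same_card[symmetric])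
  also have "\<dots> = (\<Sum>w\<in>?D. card {a. a * a ^ q * h e e + h w w = 0})" by simp
  also have "\<dots> = (\<Sum>w\<in>?D. if w \<in> ?I then 1 else q + 1)"
  proof (rule sum.cong[OF refl])
    fix w assume w: "w \<in> ?D"
    show "card {a. a * a ^ q * h e e + h w w = 0} = (if w \<in> ?I then 1 else q + 1)"
    proof (cases "h w w = 0")
      case True
      then have "{a. a * a ^ q * h e e + h w w = 0} = {0}"
        using assms(3) q_gt_1 by auto
      then show ?thesis using True w by (simp add: isotropic_def)
    next
      case False
      have "{a. a * a ^ q * h e e + h w w = 0} = {a. a * a ^ q = - h w w / h e e}"
        using assms(3) by (auto simp: field_simps eq_neg_iff_add_eq_0)
      \<comment> \<open>\<open>card_norm_fibre\<close> needs a value in the subfield with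
        \<open>q\<close> elements; \<open>conj_sym\<close> puts \<open>h w w\<close> and
        \<open>h e e\<close> there.\<close>
      moreover have "(- h w w / h e e) ^ q = - h w w / h e e"
        using conj_sym[of w w] conj_sym[of e e] by (simp add: power_divide frobenius_minus)
      ultimately show ?thesis
        using False w assms(3) card_norm_fibre[of "- h w w / h e e"] by (simp add: isotropic_def)
    qed
  qed
  also have "\<dots> = card (?D \<inter> ?I) + (q + 1) * card (?D - ?I)"
    by (simp add: sum.If_cases Diff_eq)
  finally have *: "card (isotropic C) = card ?I + (q + 1) * card (?D - ?I)"
    by (simp add: isotropic_def Int_absorb1 Int_def)
  have "card ?I + card (?D - ?I) = card ?D"
    by (subst card_Un_disjoint[symmetric]) (auto simp: isotropic_def intro: arg_cong[where f = card])
  then have "(q + 1) * card ?D = (q + 1) * card ?I + (q + 1) * card (?D - ?I)"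
    by (metis distrib_left)
  then show ?thesis using * by simp
qed

text \<open>The factor \<open>q\<close> clears the exponent \<open>2 * l - 1\<close> of the closed
  form. Splitting off an anisotropic vector lowers \<open>j\<close> and keeps the radical; at
  \<open>j = 0\<close> every vector is isotropic.\<close>

lemma card_isotropic:
  assumes "vec.subspace C" "vec.dim (radical C) = l" "vec.dim C = l + j"
  shows "real q * real (card (isotropic C)) =
    real q ^ (2 * l) * (real q ^ (2 * j) + (-1) ^ j * (real q ^ (j + 1) - real q ^ j))"
  using assms
proof (induction j arbitrary: C)
  case 0
  have "radical C = C"
    using 0 by (intro vec.subspace_dim_equal) (auto simp: subspace_radical radical_subset)
  then have "isotropic C = C" by (auto simp: radical_def isotropic_def)
  then have "card (isotropic C) = q ^ (2 * l)"
    using card_subspace[OF 0(1)] 0(3) card_field by (simp add: power_mult)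
  then show ?case by simp
next
  case (Suc j)
  obtain e where e: "e \<in> C" "h e e \<noteq> 0"
    using exists_anisotropic[OF Suc.prems(1)] Suc.prems by auto
  let ?D = "perp C e"
  have D: "vec.subspace ?D" "vec.dim ?D = l + j" "vec.dim (radical ?D) = l"
    using dim_perp[OF Suc.prems(1) e] radical_perp[OF Suc.prems(1) e] Suc.prems
    by (auto intro: subspace_perp)
  have cardD: "card ?D = q ^ (2 * (l + j))"
    using card_subspace[OF D(1)] D(2) card_field by (simp only: power_mult)
  have IH: "real q * real (card (isotropic ?D)) =
      real q ^ (2 * l) * (real q ^ (2 * j) + (-1) ^ j * (real q ^ (j + 1) - real q ^ j))"
    by (rule Suc.IH) (use D in auto)
  have "real (card (isotropic C)) + real q * real (card (isotropic ?D)) =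
      (real q + 1) * real q ^ (2 * (l + j))"
    using arg_cong[OF card_isotropic_step[OF Suc.prems(1) e], of real] cardD by (simp add: algebra_simps)
  then have eq: "real (card (isotropic C)) = (real q + 1) * real q ^ (2 * (l + j)) -
      real q ^ (2 * l) * (real q ^ (2 * j) + (-1) ^ j * (real q ^ (j + 1) - real q ^ j))"
    using IH by simp
  show ?case unfolding eq by (simp add: algebra_simps power_add power2_eq_square)
qed

text \<open>The complementary count, factored so that the ratio of two such counts simplifies in
  \<open>card_codes\<close>.\<close>

lemma card_anisotropic:
  assumes "vec.subspace C" "vec.dim (radical C) = l" "vec.dim C = l + j"
  shows "real q * real (card (C - isotropic C)) =
    real q ^ (2 * l) * (real q ^ j * (real q - 1) * (real q ^ j - (-1) ^ j))"
proof -
  have "isotropic C \<subseteq> C" by (auto simp: isotropic_def)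
  then have "real (card (C - isotropic C)) = real (card C) - real (card (isotropic C))"
    by (simp add: card_Diff_subset of_nat_diff card_mono)
  moreover have "real (card C) = real q ^ (2 * l) * real q ^ (2 * j)"
    using card_subspace[OF assms(1)] assms(3) card_field by (simp add: power_mult power_add)
  ultimately have "real q * real (card (C - isotropic C)) =
      real q * (real q ^ (2 * l) * real q ^ (2 * j)) - real q * real (card (isotropic C))"
    by (simp add: right_diff_distrib)
  then show ?thesis unfolding card_isotropic[OF assms]
    by (simp add: algebra_simps power_add power2_eq_square mult_2_right)
qed

subsection \<open>Counting subspaces by the dimension of the radical\<close>

text \<open>The inverse sends \<open>D\<close> to \<open>vec.span (insert e D)\<close>. Separate
  \<open>e\<close> and \<open>f\<close> serve both double counts: \<open>e = f\<close> anisotropic,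
  and an isotropic \<open>v\<close> split off against \<open>w\<close>.\<close>

lemma bij_betw_subspaces_perp:
  assumes U: "vec.subspace U" "e \<in> U" "h e f \<noteq> 0"
  shows "bij_betw (\<lambda>C. perp C f) {C. vec.subspace C \<and> C \<subseteq> U \<and> e \<in> C}
    {D. vec.subspace D \<and> D \<subseteq> perp U f}"
  unfolding bij_betw_def
proof
  show "inj_on (\<lambda>C. perp C f) {C. vec.subspace C \<and> C \<subseteq> U \<and> e \<in> C}"
  proof (rule inj_onI, clarify)
    have *: "C \<subseteq> C'" if C: "vec.subspace C" "vec.subspace C'" "e \<in> C" "e \<in> C'"
      and eq: "perp C f = perp C' f" for C C'
    proof
      fix x assume "x \<in> C"
      then obtain a w where w: "w \<in> perp C f" "x = a *s e + w"
        using perp_decompose[OF C(1,3) U(3)] by blast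
      then have "w \<in> C'" unfolding eq by (simp add: perp_def)
      then show "x \<in> C'"
        using w(2) C(2,4) by (simp add: vec.subspace_add vec.subspace_scale)
    qed
    fix C C' assume "vec.subspace C" "vec.subspace C'" "e \<in> C" "e \<in> C'" "perp C f = perp C' f"
    then show "C = C'" using *[of C C'] *[of C' C] by blast
  qed
  show "(\<lambda>C. perp C f) ` {C. vec.subspace C \<and> C \<subseteq> U \<and> e \<in> C} = {D. vec.subspace D \<and> D \<subseteq> perp U f}"
  proof (intro subset_antisym subsetI)
    fix D assume "D \<in> (\<lambda>C. perp C f) ` {C. vec.subspace C \<and> C \<subseteq> U \<and> e \<in> C}"
    then show "D \<in> {D. vec.subspace D \<and> D \<subseteq> perp U f}"
      by (auto simp: subspace_perp) (auto simp: perp_def)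
  next
    fix D assume D: "D \<in> {D. vec.subspace D \<and> D \<subseteq> perp U f}"
    let ?C = "vec.span (insert e D)"
    have "perp ?C f = D"
    proof (intro subset_antisym subsetI)
      fix x assume x: "x \<in> perp ?C f"
      then obtain a where a: "x - a *s e \<in> vec.span D"
        by (auto simp: perp_def vec.span_insert)
      then have xD: "x - a *s e \<in> D" using D by (simp add: vec.span_eq_iff[THEN iffD2])
      then have "h (x - a *s e) f = 0" using D by (auto simp: perp_def)
      then have "a = 0" using x U(3) by (simp add: perp_def diff_left scale_left)
      then show "x \<in> D" using xD by simp
    next
      fix x assume "x \<in> D"
      then show "x \<in> perp ?C f" using D by (auto simp: perp_def intro: vec.span_base)
    qed
    moreover have "?C \<subseteq> U"
      using D U by (intro vec.span_minimal) (auto simp: perp_def)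
    ultimately have "?C \<in> {C. vec.subspace C \<and> C \<subseteq> U \<and> e \<in> C}" "D = perp ?C f"
      by (simp_all add: vec.span_base)
    then show "D \<in> (\<lambda>C. perp C f) ` {C. vec.subspace C \<and> C \<subseteq> U \<and> e \<in> C}"
      by (rule image_eqI[rotated])
  qed
qed

lemma card_codes_containing_anisotropic:
  assumes W: "vec.subspace W" and e: "e \<in> W" "h e e \<noteq> 0"
  shows "card {C \<in> codes W (k + 1) l. e \<in> C} = card (codes (perp W e) k l)"
proof (rule bij_betw_same_card)
  have "perp C e \<in> codes (perp W e) k l \<longleftrightarrow> C \<in> codes W (k + 1) l"
    if "C \<in> {C. vec.subspace C \<and> C \<subseteq> W \<and> e \<in> C}" for C
    using that dim_perp[of C e e] radical_perp[of C e] e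
    by (auto simp: codes_def subspace_perp perp_mono)
  then have "bij_betw (\<lambda>C. perp C e)
      {C \<in> {C. vec.subspace C \<and> C \<subseteq> W \<and> e \<in> C}. C \<in> codes W (k + 1) l}
      {D \<in> {D. vec.subspace D \<and> D \<subseteq> perp W e}. D \<in> codes (perp W e) k l}"
    by (rule bij_betw_Collect[OF bij_betw_subspaces_perp[OF W e]])
  moreover have "{C \<in> {C. vec.subspace C \<and> C \<subseteq> W \<and> e \<in> C}. C \<in> codes W (k + 1) l} =
      {C \<in> codes W (k + 1) l. e \<in> C}"
    by (auto simp: codes_def)
  moreover have "{D \<in> {D. vec.subspace D \<and> D \<subseteq> perp W e}. D \<in> codes (perp W e) k l} =
      codes (perp W e) k l"
    by (auto simp: codes_def)
  ultimately show "bij_betw (\<lambda>C. perp C e) {C \<in> codes W (k + 1) l. e \<in> C} (codes (perp W e) k l)"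
    by simp
qed

section \<open>Totally isotropic subspaces\<close>

lemma mem_codes_diag_iff:
  "C \<in> codes W l l \<longleftrightarrow>
    vec.subspace C \<and> C \<subseteq> W \<and> vec.dim C = l \<and> (\<forall>x\<in>C. \<forall>y\<in>C. h x y = 0)"
proof -
  have "radical C = C" if "vec.subspace C" "vec.dim (radical C) = vec.dim C"
    using that by (intro vec.subspace_dim_equal) (auto simp: subspace_radical radical_subset)
  moreover have "radical C = C \<longleftrightarrow> (\<forall>x\<in>C. \<forall>y\<in>C. h x y = 0)"
    by (auto simp: radical_def)
  ultimately show ?thesis by (auto simp: codes_def)
qed

text \<open>A totally isotropic subspace through \<open>v\<close> lies in \<open>perp W v\<close>,
  so the bijection is applied inside \<open>perp W v\<close>.\<close>

lemma card_codes_containing_isotropic: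
  assumes W: "vec.subspace W" and v: "v \<in> W" "h v v = 0" and w: "w \<in> W" "h v w \<noteq> 0"
  shows "card {C \<in> codes W (l + 1) (l + 1). v \<in> C} = card (codes (perp (perp W v) w) l l)"
proof (rule bij_betw_same_card)
  let ?A = "{C. vec.subspace C \<and> C \<subseteq> perp W v \<and> v \<in> C}"
  let ?B = "{D. vec.subspace D \<and> D \<subseteq> perp (perp W v) w}"
  have vU: "v \<in> perp W v" using v by (simp add: perp_def)
  have "perp C w \<in> codes (perp (perp W v) w) l l \<longleftrightarrow> C \<in> codes W (l + 1) (l + 1)"
    if "C \<in> ?A" for C
  proof -
    have C: "vec.subspace C" "C \<subseteq> perp W v" "v \<in> C" using that by auto
    \<comment> \<open>\<open>C\<close> is spanned by \<open>perp C w\<close> and \<open>v\<close>,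
      and \<open>v\<close> is orthogonal to all of \<open>C\<close>.\<close>
    have "h x y = 0" if TI: "\<forall>x\<in>perp C w. \<forall>y\<in>perp C w. h x y = 0" and "x \<in> C" "y \<in> C" for x y
    proof -
      obtain a s where s: "s \<in> perp C w" "x = a *s v + s"
        using perp_decompose[OF C(1,3) w(2) \<open>x \<in> C\<close>] .
      obtain b t where t: "t \<in> perp C w" "y = b *s v + t"
        using perp_decompose[OF C(1,3) w(2) \<open>y \<in> C\<close>] .
      have "h s v = 0" "h t v = 0" using s t C(2) by (auto simp: perp_def)
      moreover have "h s t = 0" using TI s t by blast
      ultimately show ?thesis
        using s(2) t(2) v(2) orth_sym[of v t] by (simp add: add_left add_right scale_left scale_right)
    qed
    then have "(\<forall>x\<in>perp C w. \<forall>y\<in>perp C w. h x y = 0) \<longleftrightarrow> (\<forall>x\<in>C. \<forall>y\<in>C. h x y = 0)"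
      using perp_subset[of C w] by blast
    moreover have "C \<subseteq> W" using C(2) perp_subset by blast
    ultimately show ?thesis
      using dim_perp[OF C(1,3) w(2)] C(1) subspace_perp[OF C(1)] perp_mono[OF C(2)]
      unfolding mem_codes_diag_iff by simp
  qed
  then have "bij_betw (\<lambda>C. perp C w) {C \<in> ?A. C \<in> codes W (l + 1) (l + 1)}
      {D \<in> ?B. D \<in> codes (perp (perp W v) w) l l}"
    by (rule bij_betw_Collect[OF bij_betw_subspaces_perp[OF subspace_perp[OF W] vU w(2)]])
  moreover have "{C \<in> ?A. C \<in> codes W (l + 1) (l + 1)} = {C \<in> codes W (l + 1) (l + 1). v \<in> C}"
    by (auto simp: mem_codes_diag_iff perp_def)
  moreover have "{D \<in> ?B. D \<in> codes (perp (perp W v) w) l l} = codes (perp (perp W v) w) l l"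
    by (auto simp: codes_def)
  ultimately show "bij_betw (\<lambda>C. perp C w) {C \<in> codes W (l + 1) (l + 1). v \<in> C}
      (codes (perp (perp W v) w) l l)"
    by simp
qed

text \<open>With \<open>N\<close> as \<open>n - k0\<close>, the sign \<open>(-1) ^ N\<close> merges
  \<open>hull_A\<close> (odd) and \<open>hull_B\<close> (even), up to the factor
  \<open>q ^ (2 * k0)\<close> of their denominators.\<close>

definition isotropic_factor :: "nat \<Rightarrow> nat \<Rightarrow> real" where
  "isotropic_factor N i =
    (real q ^ (N - 2 * i + 2) - (-1) ^ N) * (real q ^ (N - 2 * i + 1) + (-1) ^ N) / (real q ^ (2 * i) - 1)"

text \<open>Raising \<open>M\<close> by 2 shifts the numerators by one index, so only the first
  numerator and the last denominator are new.\<close>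

lemma prod_isotropic_factor_Suc:
  assumes "2 * Suc l \<le> M + 2"
  shows "(\<Prod>i=1..Suc l. isotropic_factor (M + 2) i) * (real q ^ (2 * Suc l) - 1) =
    (real q ^ (M + 2) - (-1) ^ M) * (real q ^ (M + 1) + (-1) ^ M) * (\<Prod>i=1..l. isotropic_factor M i)"
proof -
  let ?num = "\<lambda>N i. (real q ^ (N - 2 * i + 2) - (-1) ^ N) * (real q ^ (N - 2 * i + 1) + (-1) ^ N)"
  let ?den = "\<lambda>i. real q ^ (2 * i) - 1"
  have split: "(\<Prod>i=1..m. isotropic_factor N i) = (\<Prod>i=1..m. ?num N i) / (\<Prod>i=1..m. ?den i)" for N m
    by (simp add: isotropic_factor_def prod_dividef)
  have "(\<Prod>i=1..Suc l. ?num (M + 2) i) = ?num (M + 2) 1 * (\<Prod>i=1..l. ?num (M + 2) (Suc i))"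
    by (simp add: prod.atLeast_Suc_atMost prod.shift_bounds_cl_Suc_ivl del: prod.cl_ivl_Suc)
  also have "(\<Prod>i=1..l. ?num (M + 2) (Suc i)) = (\<Prod>i=1..l. ?num M i)"
    by (rule prod.cong) (use assms in auto)
  finally have "(\<Prod>i=1..Suc l. ?num (M + 2) i) =
      (real q ^ (M + 2) - (-1) ^ M) * (real q ^ (M + 1) + (-1) ^ M) * (\<Prod>i=1..l. ?num M i)"
    by simp
  moreover have "(\<Prod>i=1..Suc l. ?den i) = (\<Prod>i=1..l. ?den i) * ?den (Suc l)" by simp
  moreover have "?den (Suc l) \<noteq> 0"
    using one_less_power[of "real q" "2 * Suc l"] q_gt_1 by simp
  ultimately show ?thesis unfolding split by simp
qed

lemma sum_card_incidence:
  fixes T :: "('a ^ 'n) set set"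
  shows "(\<Sum>v\<in>S. real (card {C\<in>T. v \<in> C})) = (\<Sum>C\<in>T. real (card {v\<in>S. v \<in> C}))"
  using sum_multicount_gen[of S T "\<lambda>v C. v \<in> C" "\<lambda>C. card {v\<in>S. v \<in> C}"]
  by (simp flip: of_nat_sum)

lemma card_isotropic_subspaces:
  assumes "vec.subspace W" "radical W = {0}" "vec.dim W = N" "2 * l \<le> N"
  shows "real (card (codes W l l)) = (\<Prod>i=1..l. isotropic_factor N i)"
  using assms
proof (induction l arbitrary: W N)
  case 0
  have "codes W 0 0 = {{0}}"
  proof (intro subset_antisym subsetI)
    fix C assume "C \<in> codes W 0 0"
    then have "vec.subspace C" "card C = 1"
      using card_subspace[of C] by (auto simp: codes_def)
    then show "C \<in> {{0}}" using vec.subspace_0 by (auto simp: card_1_singleton_iff)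
  next
    fix C :: "('a ^ 'n) set" assume "C \<in> {{0}}"
    then show "C \<in> codes W 0 0"
      using "0.prems"(1) by (auto simp: mem_codes_diag_iff vec.subspace_0)
  qed
  then show ?case by simp
next
  case (Suc l)
  note W = Suc.prems(1)
  obtain M where M: "N = M + 2" using Suc.prems(4) by (metis add.commute le_Suc_ex mult_Suc_right add_leD1)
  let ?S = "isotropic W - {0}" and ?T = "codes W (l + 1) (l + 1)"
  let ?F = "\<Prod>i=1..l. isotropic_factor M i"
  have count_v: "real (card {C\<in>?T. v \<in> C}) = ?F" if "v \<in> ?S" for v
  proof -
    have v: "v \<in> W" "h v v = 0" "v \<notin> radical W"
      using that Suc.prems(2) by (auto simp: isotropic_def)
    then obtain w where w: "w \<in> W" "h v w \<noteq> 0"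
      using orth_sym by (auto simp: radical_def)
    let ?V = "perp (perp W v) w"
    \<comment> \<open>One dimension is lost at each splitting, so the induction hypothesis applies
      to \<open>?V\<close> with \<open>M\<close>.\<close>
    have "vec.dim W = vec.dim ?V + 2"
      using dim_perp[OF W w(1), of v] dim_perp[OF subspace_perp[OF W], of v v w] v w orth_sym
      by (auto simp: perp_def)
    then have "real (card (codes ?V l l)) = ?F"
      using radical_perp_hyperbolic[OF W v(1,2) w Suc.prems(2)] Suc.prems M
      by (intro Suc.IH) (auto intro: subspace_perp)
    then show ?thesis using card_codes_containing_isotropic[OF W v(1,2) w] by simp
  qed
  have count_C: "real (card {v\<in>?S. v \<in> C}) = real q ^ (2 * Suc l) - 1" if "C \<in> ?T" for C
  proof -
    have C: "vec.subspace C" "C \<subseteq> W" "vec.dim C = Suc l" "\<forall>x\<in>C. \<forall>y\<in>C. h x y = 0"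
      using that by (auto simp: mem_codes_diag_iff)
    then have "{v\<in>?S. v \<in> C} = C - {0}" by (auto simp: isotropic_def)
    moreover have "card C = q ^ (2 * Suc l)"
      using card_subspace[OF C(1)] C(3) card_field by (simp only: power_mult)
    ultimately show ?thesis
      using vec.subspace_0[OF C(1)] q_gt_1 by (simp add: card_Diff_singleton of_nat_diff)
  qed
  have "(\<Sum>v\<in>?S. real (card {C\<in>?T. v \<in> C})) = real (card ?S) * ?F"
    using count_v by simp
  moreover have "(\<Sum>C\<in>?T. real (card {v\<in>?S. v \<in> C})) = real (card ?T) * (real q ^ (2 * Suc l) - 1)"
    using count_C by simp
  ultimately have 1: "real (card ?T) * (real q ^ (2 * Suc l) - 1) = real (card ?S) * ?F"
    using sum_card_incidence[of ?T ?S] by simp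
  have "0 \<in> isotropic W" using W by (simp add: isotropic_def vec.subspace_0)
  then have "card (isotropic W) = card ?S + 1" using card.remove[of "isotropic W" 0] by simp
  then have "real q * real (card ?S) =
      real q ^ (2 * N) + (-1) ^ N * (real q ^ (N + 1) - real q ^ N) - real q"
    using card_isotropic[OF W, of 0 N] Suc.prems(2,3) by (simp add: algebra_simps)
  \<comment> \<open>Apart from the factor \<open>q\<close>, this is the numerator of
    \<open>isotropic_factor (M + 2) 1\<close>; the parity of \<open>M\<close> settles the
    signs.\<close>
  also have "\<dots> = real q * ((real q ^ (M + 2) - (-1) ^ M) * (real q ^ (M + 1) + (-1) ^ M))"
    unfolding M by (cases "even M") (simp_all add: algebra_simps power_add power2_eq_square mult_2_right)
  finally have "real (card ?S) = (real q ^ (M + 2) - (-1) ^ M) * (real q ^ (M + 1) + (-1) ^ M)"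
    using q_gt_1 by simp
  then have "real (card ?T) * (real q ^ (2 * Suc l) - 1) =
      (\<Prod>i=1..Suc l. isotropic_factor (M + 2) i) * (real q ^ (2 * Suc l) - 1)"
    using 1 prod_isotropic_factor_Suc[of l M] Suc.prems(4) M by simp
  moreover have "real q ^ (2 * Suc l) - 1 \<noteq> 0"
    using one_less_power[of "real q" "2 * Suc l"] q_gt_1 by simp
  ultimately show ?case using M by simp
qed

text \<open>Passing to \<open>perp W e\<close> lowers \<open>j\<close> and the dimension of
  \<open>W\<close> together, so \<open>N\<close>, and with it the product of isotropic factors,
  stays fixed through the induction.\<close>

lemma card_codes:
  assumes "vec.subspace W" "radical W = {0}" "vec.dim W = N + j" "2 * l \<le> N"
  shows "real (card (codes W (l + j) l)) =
    (\<Prod>i=1..l. isotropic_factor N i) / real q ^ (2 * j * l) * real q ^ (j * N) *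
    (\<Prod>i=1..j. (real q ^ (N + i) - (-1) ^ (N + i)) / (real q ^ i - (-1) ^ i))"
  using assms
proof (induction j arbitrary: W)
  case 0
  then show ?case using card_isotropic_subspaces[of W N l] by simp
next
  case (Suc j)
  note W = Suc.prems(1)
  let ?S = "W - isotropic W" and ?T = "codes W (l + j + 1) l"
  let ?F = "(\<Prod>i=1..l. isotropic_factor N i) / real q ^ (2 * j * l) * real q ^ (j * N) *
    (\<Prod>i=1..j. (real q ^ (N + i) - (-1) ^ (N + i)) / (real q ^ i - (-1) ^ i))"
  let ?X = "real q ^ (N + Suc j) - (-1) ^ (N + Suc j)" and ?Y = "real q ^ Suc j - (-1) ^ Suc j"
  let ?c = "real q ^ (2 * l) * (real q ^ Suc j * (real q - 1) * ?Y)"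
  have count_e: "real (card {C\<in>?T. e \<in> C}) = ?F" if "e \<in> ?S" for e
  proof -
    have e: "e \<in> W" "h e e \<noteq> 0" using that by (auto simp: isotropic_def)
    have "real (card (codes (perp W e) (l + j) l)) = ?F"
      using dim_perp[OF W e] radical_perp[OF W e] Suc.prems
      by (intro Suc.IH) (auto intro: subspace_perp)
    then show ?thesis using card_codes_containing_anisotropic[OF W e, of "l + j" l] by simp
  qed
  have count_C: "real q * real (card {v\<in>?S. v \<in> C}) = ?c" if "C \<in> ?T" for C
  proof -
    have C: "vec.subspace C" "C \<subseteq> W" "vec.dim C = l + Suc j" "vec.dim (radical C) = l"
      using that by (auto simp: codes_def)
    then have "{v\<in>?S. v \<in> C} = C - isotropic C" by (auto simp: isotropic_def)
    then show ?thesis using card_anisotropic[OF C(1,4,3)] by simp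
  qed
  have "(\<Sum>v\<in>?S. real (card {C\<in>?T. v \<in> C})) = real (card ?S) * ?F"
    using count_e by simp
  moreover have "real q * (\<Sum>C\<in>?T. real (card {v\<in>?S. v \<in> C})) = real (card ?T) * ?c"
    unfolding sum_distrib_left using count_C by (subst sum.cong[OF refl count_C]) simp_all
  \<comment> \<open>Double count of the pairs \<open>(e, C)\<close>, times \<open>q\<close> because
    \<open>card_anisotropic\<close> gives \<open>q\<close> times each count.\<close>
  ultimately have "real (card ?T) * ?c = (real q * real (card ?S)) * ?F"
    unfolding sum_card_incidence[of ?T ?S, symmetric] by (simp only: mult.assoc)
  also have "real q * real (card ?S) = real q ^ (N + Suc j) * (real q - 1) * ?X"
    using card_anisotropic[OF W, of 0 "N + Suc j"] Suc.prems(2,3) by simp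
  finally have eq: "real (card ?T) * ?c = real q ^ (N + Suc j) * (real q - 1) * ?X * ?F" .
  have "real q ^ Suc j > 1" using one_less_power[of "real q" "Suc j"] q_gt_1 by simp
  then have Y: "?Y \<noteq> 0" by (cases "even j") auto
  \<comment> \<open>Read \<open>a = q ^ N\<close>, \<open>b = q ^ Suc j\<close>,
    \<open>c = q - 1\<close>, \<open>d = q ^ (2 * l)\<close>, and \<open>x\<close>,
    \<open>y\<close>, \<open>f\<close> as \<open>?X\<close>, \<open>?Y\<close>,
    \<open>?F\<close>.\<close>
  have aux: "a * b * c * x * f = f * a / d * (x / y) * (d * (b * c * y))"
    if "d \<noteq> 0" "y \<noteq> 0" for a b c d f x y :: real
    using that by simp
  have "real (card ?T) = ?F * real q ^ N / real q ^ (2 * l) * (?X / ?Y)"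
  proof -
    have "real (card ?T) * ?c = (?F * real q ^ N / real q ^ (2 * l) * (?X / ?Y)) * ?c"
      unfolding eq power_add[of _ N] by (rule aux) (use Y q_gt_1 in simp_all)
    then show ?thesis
      by (rule mult_right_cancel[THEN iffD1, rotated]) (use Y q_gt_1 in simp)
  qed
  also have "\<dots> = (\<Prod>i=1..l. isotropic_factor N i) / real q ^ (2 * Suc j * l) * real q ^ (Suc j * N) *
    (\<Prod>i=1..Suc j. (real q ^ (N + i) - (-1) ^ (N + i)) / (real q ^ i - (-1) ^ i))"
  proof -
    have "real q ^ (2 * Suc j * l) = real q ^ (2 * j * l) * real q ^ (2 * l)"
      by (simp add: power_add[symmetric] algebra_simps)
    moreover have "real q ^ (Suc j * N) = real q ^ (j * N) * real q ^ N"
      by (simp add: power_add[symmetric] algebra_simps)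
    moreover have "(\<Prod>i=1..Suc j. (real q ^ (N + i) - (-1) ^ (N + i)) / (real q ^ i - (-1) ^ i)) =
        (\<Prod>i=1..j. (real q ^ (N + i) - (-1) ^ (N + i)) / (real q ^ i - (-1) ^ i)) * (?X / ?Y)"
      by (subst prod.cl_ivl_Suc) (rule if_not_P, simp)
    moreover have "a / b * c * d * u / v * r = a / (b * v) * (c * u) * (d * r)" for a b c d u v r :: real
      by simp
    ultimately show ?thesis by (simp only:)
  qed
  finally show ?case by (simp add: add.assoc)
qed

end

subsection \<open>Hermitian hulls of codes\<close>

text \<open>Conjugate symmetry holds because \<open>x ^ q\<close> is additive in \<open>x\<close>
  and, by \<open>x ^ (q ^ 2) = x\<close>, an involution.\<close>

lemma hermitian_form_herm_inner:
  assumes "primepow q" "CARD('a::{field,finite}) = q\<^sup>2"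
  shows "hermitian_form q (herm_inner q :: 'a ^ 'n::finite \<Rightarrow> _)"
proof -
  obtain e where "prime CHAR('a)" "q = CHAR('a) ^ e"
    using primepow_eq_CHAR_power[OF assms] .
  then have sum: "(sum f A) ^ q = (\<Sum>i\<in>A. f i ^ q)" for f :: "'n \<Rightarrow> 'a" and A
    by (rule freshmans_dream_sum')
  have "(x ^ q) ^ q = x" for x :: 'a
  proof (cases "x = 0")
    case False
    have "(x ^ q) ^ q = x ^ (CARD('a) - 1) * x"
      using assms(2) zero_less_card_finite[where 'a = 'a]
      by (metis power_mult power2_eq_square power_minus_mult)
    then show ?thesis using nonzero_power_card_pred[OF False] by simp
  qed (use primepow_gt_0_nat[OF assms(1)] in auto)
  then have conj: "herm_inner q x y = herm_inner q y x ^ q" for x y :: "'a ^ 'n"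
    unfolding herm_inner_def sum by (simp add: power_mult_distrib mult.commute)
  show ?thesis
  proof (rule hermitian_form.intro)
    show "herm_inner q (x + y) z = herm_inner q x z + herm_inner q y z" for x y z :: "'a ^ 'n"
      by (simp add: herm_inner_def distrib_right sum.distrib)
    show "herm_inner q (c *s x) z = c * herm_inner q x z" for c and x z :: "'a ^ 'n"
      by (simp add: herm_inner_def sum_distrib_left mult.assoc)
  qed (fact assms conj)+
qed

theorem theorem3p11:
  fixes q n k l k0 :: nat
  assumes "primepow q"
    and "CARD('a::{field,finite}) = q ^ 2"
    and "CARD('n::finite) = n"
    and "n > 0" and "k > 0" and "l > 0"
    and "l \<le> k" and "k \<le> n - l"
    and "k0 = k - l"
  shows "real (card (HHull q k l :: ('a ^ 'n) set set)) =
    (if odd (n - k0)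
     then (\<Prod>i=1..l. hull_A q n k0 i) * real q ^ (k0 * (n - k0)) *
       (\<Prod>i=1..k0. (real q ^ (n - k0 + i) - (-1) ^ (n - k0 + i)) / (real q ^ i - (-1) ^ i))
     else (\<Prod>i=1..l. hull_B q n k0 i) * real q ^ (k0 * (n - k0)) *
       (\<Prod>i=1..k0. (real q ^ (n - k0 + i) - (-1) ^ (n - k0 + i)) / (real q ^ i - (-1) ^ i)))"
proof -
  interpret hermitian_form q "herm_inner q :: 'a ^ 'n \<Rightarrow> _"
    by (rule hermitian_form_herm_inner) fact+
  let ?W = "UNIV :: ('a ^ 'n) set" and ?N = "n - k0"
  have HHull: "HHull q k l = codes ?W k l"
    unfolding HHull_def codes_def linear_code_def herm_hull_def herm_dual_def radical_def
    by (intro Collect_cong) (auto simp: Int_def)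
  have "y = 0" if y: "y \<in> radical ?W" for y
  proof -
    have "y $ i = 0" for i
    proof -
      \<comment> \<open>Pairing with a unit vector isolates the conjugate of one coordinate.\<close>
      have "herm_inner q (axis i 1) y = 0" using y by (simp add: radical_def)
      then have "(y $ i) ^ q = 0"
        by (simp add: herm_inner_def axis_def if_distrib[of "\<lambda>x. x * _"] cong: if_cong)
      then show ?thesis by simp
    qed
    then show ?thesis by (simp add: vec_eq_iff)
  qed
  then have rad: "radical ?W = {0}" by (auto simp: radical_def)
  have "(q ^ 2) ^ vec.dim ?W = (q ^ 2) ^ n"
    using card_subspace[OF vec.subspace_UNIV, where 'a = 'a and 'n = 'n] assms(2,3) by simp
  then have dim: "vec.dim ?W = n"
    using power_inject_exp[of "q ^ 2"] q_gt_1 by (metis one_less_power zero_less_numeral)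
  have N: "n = ?N + k0" "2 * l \<le> ?N" "k = l + k0" using assms by auto
  have codes: "real (card (codes ?W k l)) =
      (\<Prod>i=1..l. isotropic_factor ?N i) / real q ^ (2 * k0 * l) * real q ^ (k0 * ?N) *
      (\<Prod>i=1..k0. (real q ^ (?N + i) - (-1) ^ (?N + i)) / (real q ^ i - (-1) ^ i))"
    using card_codes[OF vec.subspace_UNIV rad, of ?N k0 l] dim N by simp
  \<comment> \<open>Each of the \<open>l\<close> factors takes one \<open>q ^ (2 * k0)\<close>,
    which completes the denominators of \<open>hull_A\<close> and \<open>hull_B\<close>.\<close>
  have "(\<Prod>i=1..l. isotropic_factor ?N i) / real q ^ (2 * k0 * l) =
      (\<Prod>i=1..l. isotropic_factor ?N i / real q ^ (2 * k0))"
    by (simp add: prod_dividef power_mult)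
  also have "\<dots> = (if odd ?N then (\<Prod>i=1..l. hull_A q n k0 i) else (\<Prod>i=1..l. hull_B q n k0 i))"
    by (simp add: isotropic_factor_def hull_A_def hull_B_def mult.commute)
  finally show ?thesis unfolding HHull codes by simp
qed

end
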